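(* The moduli problem $\mathcal{M}:\mathbf{Top}^{op}\to\mathbf{Sets}$ sending a topological space $X$ to the set of oriented continuous families of triangles over $X$ up to isomorphism (and a continuous map to pullback of families along it) admits a fine moduli space, which is the open cone $$M=\{(x,y,z)\in\mathbb{R}^3 \mid x+y>z>0,\ x+z>y>0,\ y+z>x>0\}.$$
   Context: $\mathbf{Top}$ is the category of topological spaces and continuous maps. Triangles are non-degenerate Euclidean triangles; the endpoints of a triangle are its three vertices. A map $f:X\to Y$ in $\mathbf{Top}$ is proper if it is closed and $f^{-1}(y)$ is compact for every $y\in Y$. A continuous family of triangles over a base space $X$ is a continuous proper map $\mathcal{F}\to X$ making $\mathcal{F}$ a fiber bundle over $X$, such that there is a distance map $d:\mathcal{F}\times_X\mathcal{F}\to\mathbb{R}_{\ge 0}$ whose restriction to $\mathcal{F}_x\times\mathcal{F}_x$ is, for every $x\in X$, a metric on the fiber $\mathcal{F}_x$ making it isometric to a triangle. Moreover, to every fiber $\mathcal{F}_x$ one associates a triple $(A_x,B_x,C_x)$ of the endpoints of this triangle, and there exists a global ordering $(A,B,C)$ such that the induced functions $X\to\mathbb{R}_{\ge 0}$ given by $x\mapsto d(A_x,B_x)$, $x\mapsto d(A_x,C_x)$ and $x\mapsto d(B_x,C_x)$ are continuous. Such a family together with the ordering, $(\mathcal{F},A,B,C)$, is called an oriented continuous family of triangles. An isomorphism of oriented continuous families over $X$ is a homeomorphism over $X$ that induces isometries on fibers and carries the triple of endpoints $(A_x,B_x,C_x)$ to the corresponding triple, in order, for every $x\in X$. For a continuous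 map $f:Y\to X$, the map $\mathcal{M}(f)$ sends the class of $\mathcal{F}$ to the class of the pullback of $\mathcal{F}$ along $f$, with the natural orientation coming from $\mathcal{F}$. A point $(x,y,z)\in M$ corresponds to the triangle with ordered endpoints $A,B,C$ and edge lengths $x=|AB|$, $y=|AC|$, $z=|BC|$. A moduli problem for topological spaces is a functor $\mathcal{M}:\mathbf{Top}^{op}\to\mathbf{Sets}$; a topological space $M$ is a fine moduli space for $\mathcal{M}$ if there is a natural isomorphism $\mathcal{M}\cong\mathrm{Hom}_{\mathbf{Top}}(-,M)$.
   Formalization: The endpoints A, B, C are required to be continuous sections and the distance map d to be continuous; with only continuous edge lengths, the constant equilateral family over [0,1] with labels rotated for x>0 has the same edge lengths as the unrotated one but is not isomorphic to it. *)

theory Defs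
  imports "HOL-Analysis.Analysis" "HOL-Library.Equipollence"
begin

section \<open>Presheaves on spaces and fine moduli spaces\<close>

text \<open>
  The type \<open>'u\<close> plays the role of a Grothendieck universe: the objects of \<open>Top\<close> are all
  topologies whose underlying set is a subset of \<open>'u\<close>. Theorems are stated for an arbitrary
  \<open>'u\<close> that is at least as large as the continuum, so no bound is put on the size of the spaces.
  Morphisms are set-theoretic functions, i.e. functions that are \<open>extensional\<close> on the carrier.
\<close>

definition Hom_Top :: "'a topology \<Rightarrow> 'b topology \<Rightarrow> ('a \<Rightarrow> 'b) set" where
  "Hom_Top X Y = {f \<in> extensional (topspace X). continuous_map X Y f}"

text \<open>
  A functor from the opposite of \<open>Top\<close> to sets, given by its object part \<open>ob\<close> and its morphism
  part \<open>mor\<close>; \<open>mor Y X f\<close> is the map \<open>ob X \<rightarrow> ob Y\<close> induced by \<open>f : Y \<rightarrow> X\<close>.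
\<close>

definition moduli_problem ::
  "('u topology \<Rightarrow> 's set) \<Rightarrow> ('u topology \<Rightarrow> 'u topology \<Rightarrow> ('u \<Rightarrow> 'u) \<Rightarrow> 's \<Rightarrow> 's) \<Rightarrow> bool" where
  "moduli_problem ob mor \<longleftrightarrow>
     (\<forall>X Y. \<forall>f \<in> Hom_Top Y X. \<forall>s \<in> ob X. mor Y X f s \<in> ob Y) \<and>
     (\<forall>X. \<forall>s \<in> ob X. mor X X (restrict id (topspace X)) s = s) \<and>
     (\<forall>X Y Z. \<forall>f \<in> Hom_Top Y X. \<forall>g \<in> Hom_Top Z Y. \<forall>s \<in> ob X.
        mor Z X (compose (topspace Z) f g) s = mor Z Y g (mor Y X f s))"

text \<open>\<open>M\<close> is a fine moduli space by way of the natural isomorphism \<open>\<eta> : ob \<cong> Hom(-, M)\<close>.\<close>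

definition fine_moduli_space_via ::
  "('u topology \<Rightarrow> 's set) \<Rightarrow> ('u topology \<Rightarrow> 'u topology \<Rightarrow> ('u \<Rightarrow> 'u) \<Rightarrow> 's \<Rightarrow> 's)
    \<Rightarrow> 'm topology \<Rightarrow> ('u topology \<Rightarrow> 's \<Rightarrow> 'u \<Rightarrow> 'm) \<Rightarrow> bool" where
  "fine_moduli_space_via ob mor M \<eta> \<longleftrightarrow>
     (\<forall>X. bij_betw (\<eta> X) (ob X) (Hom_Top X M)) \<and>
     (\<forall>X Y. \<forall>f \<in> Hom_Top Y X. \<forall>s \<in> ob X.
        \<eta> Y (mor Y X f s) = compose (topspace Y) (\<eta> X s) f)"

section \<open>Oriented continuous families of triangles\<close>

text \<open>
  Over \<open>X\<close> the total space \<open>E\<close> is locally homeomorphic to a product with the fibre \<open>T\<close>.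
  Taking \<open>T\<close> on the same type as \<open>E\<close> is no restriction: if \<open>X\<close> is nonempty, \<open>T\<close> can be taken to
  be a fibre of \<open>p\<close>.
\<close>

definition fiber_bundle :: "'e topology \<Rightarrow> 'x topology \<Rightarrow> ('e \<Rightarrow> 'x) \<Rightarrow> bool" where
  "fiber_bundle E X p \<longleftrightarrow> continuous_map E X p \<and>
     (\<exists>T :: 'e topology. \<forall>x \<in> topspace X. \<exists>U \<phi>. openin X U \<and> x \<in> U \<and>
        homeomorphic_map (subtopology E {e \<in> topspace E. p e \<in> U})
                         (prod_topology (subtopology X U) T) \<phi> \<and>
        (\<forall>e \<in> topspace E. p e \<in> U \<longrightarrow> fst (\<phi> e) = p e))"

text \<open>
  The set \<open>S\<close> with the distance \<open>d\<close> is isometric to a (solid, non-degenerate) triangle in the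
  Euclidean plane, with \<open>A\<close>, \<open>B\<close>, \<open>C\<close> corresponding to its three vertices.
\<close>

definition isometric_to_triangle ::
  "'e set \<Rightarrow> ('e \<Rightarrow> 'e \<Rightarrow> real) \<Rightarrow> 'e \<Rightarrow> 'e \<Rightarrow> 'e \<Rightarrow> bool" where
  "isometric_to_triangle S d A B C \<longleftrightarrow> A \<in> S \<and> B \<in> S \<and> C \<in> S \<and>
     (\<exists>a b c \<phi>. \<not> collinear {a, b, c :: real^2} \<and>
        bij_betw \<phi> S (convex hull {a, b, c}) \<and>
        (\<forall>u \<in> S. \<forall>v \<in> S. dist (\<phi> u) (\<phi> v) = d u v) \<and>
        \<phi> A = a \<and> \<phi> B = b \<and> \<phi> C = c)"

text \<open>
  Only the values of \<open>fdist\<close> on pairs of points in a common fibre, and of \<open>ptA\<close>, \<open>ptB\<close>, \<open>ptC\<close> on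
  the base, are meaningful; isomorphisms of families ignore all other values.
\<close>

record ('x, 'e) triangle_family =
  tot :: "'e topology"
  proj :: "'e \<Rightarrow> 'x"
  fdist :: "'e \<Rightarrow> 'e \<Rightarrow> real"
  ptA :: "'x \<Rightarrow> 'e"
  ptB :: "'x \<Rightarrow> 'e"
  ptC :: "'x \<Rightarrow> 'e"

definition fiber :: "('x, 'e) triangle_family \<Rightarrow> 'x \<Rightarrow> 'e set" where
  "fiber F x = {e \<in> topspace (tot F). proj F e = x}"

definition fiber_square :: "('x, 'e) triangle_family \<Rightarrow> ('e \<times> 'e) topology" where
  "fiber_square F = subtopology (prod_topology (tot F) (tot F)) {(u, v). proj F u = proj F v}"

text \<open>
  The distance map is a morphism of \<open>Top\<close>, and the ordering is global in the sense that the three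
  endpoints are continuous sections. Continuity of the edge lengths alone would not be enough: the
  constant equilateral family over \<open>[0,1]\<close> whose labels are rotated away from \<open>0\<close> has the same edge
  lengths as the one with constant labels, but is not isomorphic to it.

  \<open>Metric_space\<close> constrains the distance outside the carrier as well, hence the cut-off.
\<close>

definition oriented_family :: "'x topology \<Rightarrow> ('x, 'e) triangle_family \<Rightarrow> bool" where
  "oriented_family X F \<longleftrightarrow>
     continuous_map (tot F) X (proj F) \<and> proper_map (tot F) X (proj F) \<and>
     fiber_bundle (tot F) X (proj F) \<and>
     continuous_map (fiber_square F) (top_of_set {0..}) (\<lambda>(u, v). fdist F u v) \<and>
     (\<forall>x \<in> topspace X.
        Metric_space (fiber F x)
          (\<lambda>u v. if u \<in> fiber F x \<and> v \<in> fiber F x then fdist F u v else 0) \<and>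
        isometric_to_triangle (fiber F x) (fdist F) (ptA F x) (ptB F x) (ptC F x)) \<and>
     continuous_map X (tot F) (ptA F) \<and>
     continuous_map X (tot F) (ptB F) \<and>
     continuous_map X (tot F) (ptC F) \<and>
     continuous_map X (top_of_set {0..}) (\<lambda>x. fdist F (ptA F x) (ptB F x)) \<and>
     continuous_map X (top_of_set {0..}) (\<lambda>x. fdist F (ptA F x) (ptC F x)) \<and>
     continuous_map X (top_of_set {0..}) (\<lambda>x. fdist F (ptB F x) (ptC F x))"

definition family_iso ::
  "'x topology \<Rightarrow> ('x, 'e) triangle_family \<Rightarrow> ('x, 'g) triangle_family \<Rightarrow> bool" where
  "family_iso X F G \<longleftrightarrow> (\<exists>\<phi>.
     homeomorphic_map (tot F) (tot G) \<phi> \<and>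
     (\<forall>e \<in> topspace (tot F). proj G (\<phi> e) = proj F e) \<and>
     (\<forall>x \<in> topspace X. \<forall>u \<in> fiber F x. \<forall>v \<in> fiber F x. fdist G (\<phi> u) (\<phi> v) = fdist F u v) \<and>
     (\<forall>x \<in> topspace X. \<phi> (ptA F x) = ptA G x \<and> \<phi> (ptB F x) = ptB G x \<and> \<phi> (ptC F x) = ptC G x))"

definition pullback_family ::
  "'y topology \<Rightarrow> ('y \<Rightarrow> 'x) \<Rightarrow> ('x, 'e) triangle_family \<Rightarrow> ('y, 'y \<times> 'e) triangle_family" where
  "pullback_family Y f F =
     \<lparr> tot = subtopology (prod_topology Y (tot F)) {(y, e). f y = proj F e},
       proj = fst,
       fdist = (\<lambda>u v. fdist F (snd u) (snd v)),
       ptA = (\<lambda>y. (y, ptA F (f y))),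
       ptB = (\<lambda>y. (y, ptB F (f y))),
       ptC = (\<lambda>y. (y, ptC F (f y))) \<rparr>"

section \<open>The moduli problem and the open cone\<close>

definition families :: "'u topology \<Rightarrow> ('u, 'u) triangle_family set" where
  "families X = {F. oriented_family X F}"

definition iso_rel ::
  "'u topology \<Rightarrow> (('u, 'u) triangle_family \<times> ('u, 'u) triangle_family) set" where
  "iso_rel X = {(F, G). F \<in> families X \<and> G \<in> families X \<and> family_iso X F G}"

definition iso_class ::
  "'u topology \<Rightarrow> ('u, 'u) triangle_family \<Rightarrow> ('u, 'u) triangle_family set" where
  "iso_class X F = iso_rel X `` {F}"

definition triangles_ob :: "'u topology \<Rightarrow> ('u, 'u) triangle_family set set" where
  "triangles_ob X = families X // iso_rel X"

text \<open>
  The fibre product has a total space on the type \<open>'u \<times> 'u\<close>, so the class of the pullback is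
  formed as the set of all families on \<open>'u\<close> isomorphic to it. For infinite \<open>'u\<close> there always are
  such families, since \<open>'u \<times> 'u\<close> embeds into \<open>'u\<close>.
\<close>

definition triangles_mor ::
  "'u topology \<Rightarrow> 'u topology \<Rightarrow> ('u \<Rightarrow> 'u)
    \<Rightarrow> ('u, 'u) triangle_family set \<Rightarrow> ('u, 'u) triangle_family set" where
  "triangles_mor Y X f c = {G \<in> families Y. \<exists>F \<in> c. family_iso Y (pullback_family Y f F) G}"

definition edge_lengths :: "('x, 'e) triangle_family \<Rightarrow> 'x \<Rightarrow> real \<times> real \<times> real" where
  "edge_lengths F x =
     (fdist F (ptA F x) (ptB F x), fdist F (ptA F x) (ptC F x), fdist F (ptB F x) (ptC F x))"

definition triangle_cone :: "(real \<times> real \<times> real) topology" where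
  "triangle_cone =
     top_of_set {(x, y, z). x + y > z \<and> z > 0 \<and> x + z > y \<and> y > 0 \<and> y + z > x \<and> x > 0}"

end

theory Submission
  imports Defs
begin

text \<open>
  A point of a triangle is determined by its distances to the three vertices: its barycentric
  coordinates are rational functions of the squares of these distances and of the squared edge
  lengths, and the denominator, the Gram determinant of two edges, does not vanish on the open
  cone. For an oriented family \<open>F\<close> over \<open>X\<close> these formulas give coordinates on the whole total space
  (\<open>fiber_coords\<close>), continuous because the distance map and the three endpoint sections are. So the
  total space maps continuously and bijectively to \<open>X \<times> \<Delta>\<close>, where \<open>\<Delta>\<close> is the closed coordinate
  simplex in the plane. This map lies over \<open>X\<close>, has a proper projection as its first component
  and a map to a Hausdorff space as its second, hence is proper, hence closed, hence a
  homeomorphism.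

  Therefore every oriented family is isomorphic to a model family on \<open>X \<times> \<Delta>\<close> whose distance
  depends only on the edge lengths (\<open>family_iso_model_family\<close>). The edge lengths form a continuous
  map from \<open>X\<close> to the cone, the classifying map, and they are invariant under isomorphism, so two
  families are isomorphic iff their classifying maps agree (\<open>family_iso_iff_classifying_map_eq\<close>).
  The model family of \<open>F\<close> pulls back along \<open>f\<close> to the model family of the edge lengths composed
  with \<open>f\<close>, which gives naturality (\<open>pullback_family_iso_iff\<close>).

  Conversely the model family of any continuous map \<open>e\<close> from \<open>X\<close> to the cone is oriented, with
  classifying map \<open>e\<close>. Its total space has underlying set in \<open>'u \<times> \<real> \<times> \<real>\<close>; since \<open>'u\<close> is at
  least as large as the continuum, this type injects into \<open>'u\<close> and the family can be transported
  there (\<open>classifying_map_surj\<close>).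
\<close>

section \<open>Triangles in barycentric coordinates\<close>

text \<open>
  Edge lengths are ordered as \<open>x = |AB|\<close>, \<open>y = |AC|\<close>, \<open>z = |BC|\<close>. By the law of cosines the
  following is the inner product of the edge vectors \<open>B - A\<close> and \<open>C - A\<close>.
\<close>

definition gram :: "real \<times> real \<times> real \<Rightarrow> real" where
  "gram = (\<lambda>(x, y, z). (x\<^sup>2 + y\<^sup>2 - z\<^sup>2) / 2)"

definition gram_det :: "real \<times> real \<times> real \<Rightarrow> real" where
  "gram_det e = (fst e)\<^sup>2 * (fst (snd e))\<^sup>2 - (gram e)\<^sup>2"

text \<open>
  The squared length of the vector \<open>s (B - A) + t (C - A)\<close>, which is the quadratic form of the Gram
  matrix of the two edge vectors. Written in terms of edge lengths it makes sense for a varying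
  triangle that is not embedded in a plane.
\<close>

definition sqdist :: "real \<times> real \<times> real \<Rightarrow> real \<times> real \<Rightarrow> real" where
  "sqdist e = (\<lambda>(s, t). s\<^sup>2 * (fst e)\<^sup>2 + 2 * s * t * gram e + t\<^sup>2 * (fst (snd e))\<^sup>2)"

definition simplex2 :: "(real \<times> real) set" where
  "simplex2 = {(s, t). 0 \<le> s \<and> 0 \<le> t \<and> s + t \<le> 1}"

text \<open>
  The coordinates \<open>(s, t)\<close> of a point \<open>P = A + s (B - A) + t (C - A)\<close> from its squared distances \<open>a\<close>,
  \<open>b\<close>, \<open>c\<close> to the vertices: \<open>m\<close> and \<open>n\<close> are the inner products of \<open>P - A\<close> with the two edge vectors,
  and the formula is Cramer's rule for the Gram matrix.
\<close>

definition barycentric :: "real \<times> real \<times> real \<Rightarrow> real \<Rightarrow> real \<Rightarrow> real \<Rightarrow> real \<times> real" where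
  "barycentric e a b c =
     (let m = (a - b + (fst e)\<^sup>2) / 2; n = (a - c + (fst (snd e))\<^sup>2) / 2 in
      ((m * (fst (snd e))\<^sup>2 - n * gram e) / gram_det e, (n * (fst e)\<^sup>2 - m * gram e) / gram_det e))"

text \<open>
  By Heron's formula the Gram determinant is a quarter of the product of \<open>x + y + z\<close> and the three
  differences that are positive by the strict triangle inequalities.
\<close>

lemma gram_det_pos:
  assumes "e \<in> topspace triangle_cone"
  shows "gram_det e > 0"
proof -
  obtain x y z where e: "e = (x, y, z)" by (cases e)
  have "4 * gram_det e = (x + y + z) * (x + y - z) * ((x + z - y) * (y + z - x))"
    by (simp add: e gram_det_def gram_def field_simps power2_eq_square)
  moreover have "(x + y + z) * (x + y - z) * ((x + z - y) * (y + z - x)) > 0"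
    using assms by (intro mult_pos_pos) (auto simp: e triangle_cone_def)
  ultimately show ?thesis by simp
qed

text \<open>
  Completing the square shows that the quadratic form is nonnegative where \<open>gram_det\<close> is positive.
\<close>

lemma sqdist_complete_square:
  "(fst e)\<^sup>2 * sqdist e (s, t) = (s * (fst e)\<^sup>2 + t * gram e)\<^sup>2 + t\<^sup>2 * gram_det e"
  by (simp add: sqdist_def gram_det_def algebra_simps power2_eq_square)

lemma sqdist_nonneg:
  assumes "e \<in> topspace triangle_cone"
  shows "sqdist e p \<ge> 0"
proof -
  obtain s t where p: "p = (s, t)" by (cases p)
  have "(fst e)\<^sup>2 * sqdist e (s, t) \<ge> 0"
    unfolding sqdist_complete_square using gram_det_pos[OF assms] by simp
  moreover have "(fst e)\<^sup>2 > 0" using assms by (auto simp: triangle_cone_def)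
  ultimately show ?thesis by (simp add: p zero_le_mult_iff)
qed

lemma sqdist_vertices:
  "sqdist (x, y, z) (0, 0) = 0" "sqdist (x, y, z) (-1, 0) = x\<^sup>2"
  "sqdist (x, y, z) (0, -1) = y\<^sup>2" "sqdist (x, y, z) (1, -1) = z\<^sup>2"
  by (auto simp: sqdist_def gram_def field_simps)

text \<open>
  This is why distances to the vertices separate the points of a triangle: the squared distances
  have the same quadratic part, so their differences are affine in \<open>p\<close>.
\<close>

lemma barycentric_sqdist:
  assumes "e \<in> topspace triangle_cone"
  shows "barycentric e (sqdist e (p - (0, 0))) (sqdist e (p - (1, 0))) (sqdist e (p - (0, 1))) = p"
proof -
  obtain s t where p: "p = (s, t)" by (cases p)
  have D: "gram_det e \<noteq> 0" using gram_det_pos[OF assms] by simp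
  define X Y g where "X = (fst e)\<^sup>2" and "Y = (fst (snd e))\<^sup>2" and "g = gram e"
  have m: "(sqdist e (s, t) - sqdist e (s - 1, t) + X) / 2 = s * X + t * g"
    and n: "(sqdist e (s, t) - sqdist e (s, t - 1) + Y) / 2 = s * g + t * Y"
    by (simp_all add: sqdist_def X_def Y_def g_def field_simps power2_eq_square)
  have G: "gram_det e = X * Y - g * g"
    by (simp add: gram_det_def X_def Y_def g_def power2_eq_square)
  have "((s * X + t * g) * Y - (s * g + t * Y) * g) / gram_det e = s"
    "((s * g + t * Y) * X - (s * X + t * g) * g) / gram_det e = t"
    using D by (simp_all add: field_simps) (simp_all add: G algebra_simps)
  then show ?thesis
    unfolding p barycentric_def Let_def minus_prod_def X_def[symmetric] Y_def[symmetric] g_def[symmetric]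
    by (simp only: fst_conv snd_conv diff_0_right m n)
qed

lemma dist_barycentric:
  fixes a b c :: "'v::real_inner"
  shows "(dist (a + s *\<^sub>R (b - a) + t *\<^sub>R (c - a)) (a + s' *\<^sub>R (b - a) + t' *\<^sub>R (c - a)))\<^sup>2
    = sqdist (dist a b, dist a c, dist b c) (s - s', t - t')"
proof -
  define u v where "u = b - a" and "v = c - a"
  have d: "dist a b = norm u" "dist a c = norm v" "dist b c = norm (u - v)"
    by (simp_all add: u_def v_def dist_norm norm_minus_commute)
  have "dist (a + s *\<^sub>R u + t *\<^sub>R v) (a + s' *\<^sub>R u + t' *\<^sub>R v)
      = norm ((s - s') *\<^sub>R u + (t - t') *\<^sub>R v)"
    unfolding dist_norm by (simp add: algebra_simps)
  moreover have "(norm ((s - s') *\<^sub>R u + (t - t') *\<^sub>R v))\<^sup>2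
      = sqdist (norm u, norm v, norm (u - v)) (s - s', t - t')"
    by (simp add: sqdist_def gram_def power2_norm_eq_inner inner_simps inner_commute)
      (simp add: field_simps power2_eq_square)
  ultimately show ?thesis
    unfolding d u_def[symmetric] v_def[symmetric] by simp
qed

text \<open>
  Equality in a triangle inequality would put one vertex on the segment between the other two.
\<close>

lemma edges_in_cone:
  fixes a b c :: "'v::euclidean_space"
  assumes "\<not> collinear {a, b, c}"
  shows "(dist a b, dist a c, dist b c) \<in> topspace triangle_cone"
proof -
  have "\<not> between (a, b) c" "\<not> between (a, c) b" "\<not> between (b, c) a"
    using assms by (auto simp: collinear_between_cases between_commute)
  then show ?thesis
    using dist_triangle[of a b c] dist_triangle[of a c b] dist_triangle[of b c a]
    by (auto simp: between triangle_cone_def dist_commute)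
qed

text \<open>
  Put \<open>a\<close> at the origin and \<open>b\<close> on the first axis. The coordinates \<open>(g, h)\<close> of \<open>c\<close> are then forced:
  \<open>x g\<close> is the inner product of the two edges and \<open>(x h)\<^sup>2\<close> is the Gram determinant.
\<close>

lemma triangle_with_edges:
  assumes "e \<in> topspace triangle_cone"
  obtains a b c :: "real^2" where "\<not> collinear {a, b, c}" "e = (dist a b, dist a c, dist b c)"
proof -
  obtain x y z where e: "e = (x, y, z)" by (cases e)
  have pos: "x > 0" "y > 0" "z > 0" "x + y > z" "x + z > y" "y + z > x"
    using assms by (auto simp: e triangle_cone_def)
  define g h where "g = gram e / x" and "h = sqrt (gram_det e) / x"
  define a b c :: "real^2" where "a = vector [0, 0]" and "b = vector [x, 0]" and "c = vector [g, h]"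
  have h2: "h\<^sup>2 = y\<^sup>2 - g\<^sup>2"
    using gram_det_pos[OF assms] pos
    by (simp add: h_def g_def power_divide) (simp add: gram_det_def e field_simps)
  have "x * g = (x\<^sup>2 + y\<^sup>2 - z\<^sup>2) / 2" using pos by (simp add: g_def e gram_def)
  then have 3: "(x - g)\<^sup>2 + h\<^sup>2 = z\<^sup>2" by (simp add: h2 power2_diff algebra_simps)
  have d: "dist a b = x" "dist a c = y" "dist b c = z"
    using pos 3
    by (simp_all add: a_def b_def c_def dist_norm norm_vec_def L2_set_def sum_2 h2)
  have "\<not> collinear {a, b, c}"
    using pos d by (auto simp: collinear_between_cases between dist_commute)
  with d e show ?thesis using that by blast
qed

definition triangle_point :: "'v::real_vector \<Rightarrow> 'v \<Rightarrow> 'v \<Rightarrow> real \<times> real \<Rightarrow> 'v" where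
  "triangle_point a b c = (\<lambda>(s, t). a + s *\<^sub>R (b - a) + t *\<^sub>R (c - a))"

lemma dist_triangle_point:
  fixes a b c :: "'v::real_inner"
  shows "dist (triangle_point a b c p) (triangle_point a b c q)
    = sqrt (sqdist (dist a b, dist a c, dist b c) (p - q))"
  using dist_barycentric[of a "fst p" b "snd p" c "fst q" "snd q", symmetric]
  by (simp add: triangle_point_def case_prod_beta minus_prod_def)

lemma bij_betw_triangle_point:
  fixes a b c :: "'v::euclidean_space"
  assumes "\<not> collinear {a, b, c}"
  shows "bij_betw (triangle_point a b c) simplex2 (convex hull {a, b, c})"
proof -
  let ?e = "(dist a b, dist a c, dist b c)" and ?P = "triangle_point a b c"
  have e: "?e \<in> topspace triangle_cone" using assms by (rule edges_in_cone)
  have "inj ?P"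
  proof (rule injI)
    fix p q assume eq: "?P p = ?P q"
    have "sqrt (sqdist ?e (p - r)) = sqrt (sqdist ?e (q - r))" for r
      unfolding dist_triangle_point[symmetric] eq ..
    then have r: "sqdist ?e (p - r) = sqdist ?e (q - r)" for r
      by (simp only: real_sqrt_eq_iff)
    show "p = q"
      using barycentric_sqdist[OF e, of p] barycentric_sqdist[OF e, of q] unfolding r by (rule trans[OF sym])
  qed
  moreover have "?P ` simplex2 = convex hull {a, b, c}"
    unfolding convex_hull_3_alt simplex2_def triangle_point_def by (fastforce simp: image_iff)
  ultimately show ?thesis by (auto simp: bij_betw_def inj_on_def)
qed

text \<open>
  The existential choice of a triangle in the plane is traded for the choice of edge lengths: all
  triangles are parametrized by the same simplex, and only the quadratic form on it varies. Over a
  base space this makes all fibres comparable.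
\<close>

lemma isometric_to_triangle_iff:
  "isometric_to_triangle S d A B C \<longleftrightarrow> A \<in> S \<and> B \<in> S \<and> C \<in> S \<and>
     (\<exists>e \<in> topspace triangle_cone. \<exists>\<psi>. bij_betw \<psi> S simplex2 \<and>
        (\<forall>u\<in>S. \<forall>v\<in>S. d u v = sqrt (sqdist e (\<psi> u - \<psi> v))) \<and>
        \<psi> A = (0, 0) \<and> \<psi> B = (1, 0) \<and> \<psi> C = (0, 1))" (is "?L \<longleftrightarrow> ?R")
proof -
  show ?thesis
  proof
    assume ?L
    then obtain a b c \<phi> where nc: "\<not> collinear {a, b, c :: real^2}"
      and \<phi>: "bij_betw \<phi> S (convex hull {a, b, c})"
        "\<forall>u\<in>S. \<forall>v\<in>S. dist (\<phi> u) (\<phi> v) = d u v" "\<phi> A = a" "\<phi> B = b" "\<phi> C = c"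
      and S: "A \<in> S" "B \<in> S" "C \<in> S"
      unfolding isometric_to_triangle_def by blast
    let ?P = "triangle_point a b c"
    let ?Q = "the_inv_into simplex2 ?P"
    note bij = bij_betw_triangle_point[OF nc]
    have Q: "bij_betw ?Q (convex hull {a, b, c}) simplex2"
      using bij bij_betw_the_inv_into by blast
    have PQ: "?P (?Q w) = w" if "w \<in> convex hull {a, b, c}" for w
      using bij that by (intro f_the_inv_into_f_bij_betw) auto
    have "?Q (?P p) = p" if "p \<in> simplex2" for p
      using bij that by (intro the_inv_into_f_f) (auto simp: bij_betw_def)
    from this[of "(0, 0)"] this[of "(1, 0)"] this[of "(0, 1)"]
    have "?Q a = (0, 0)" "?Q b = (1, 0)" "?Q c = (0, 1)"
      by (simp_all add: simplex2_def triangle_point_def)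
    moreover have "bij_betw (?Q \<circ> \<phi>) S simplex2"
      using \<phi>(1) Q by (rule bij_betw_trans)
    moreover have "d u v = sqrt (sqdist (dist a b, dist a c, dist b c) ((?Q \<circ> \<phi>) u - (?Q \<circ> \<phi>) v))"
      if "u \<in> S" "v \<in> S" for u v
    proof -
      have "\<phi> u \<in> convex hull {a, b, c}" "\<phi> v \<in> convex hull {a, b, c}"
        using that \<phi>(1) by (auto simp: bij_betw_def)
      then have "dist (\<phi> u) (\<phi> v) = sqrt (sqdist (dist a b, dist a c, dist b c) (?Q (\<phi> u) - ?Q (\<phi> v)))"
        using dist_triangle_point[of a b c "?Q (\<phi> u)" "?Q (\<phi> v)"] PQ by simp
      with \<phi>(2) that show ?thesis by simp
    qed
    ultimately show ?R
      using S \<phi> edges_in_cone[OF nc]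
      by (intro conjI bexI[of _ "(dist a b, dist a c, dist b c)"] exI[of _ "?Q \<circ> \<phi>"]) auto
  next
    assume ?R
    then obtain e \<psi> where S: "A \<in> S" "B \<in> S" "C \<in> S" and e: "e \<in> topspace triangle_cone"
      and \<psi>: "bij_betw \<psi> S simplex2" "\<forall>u\<in>S. \<forall>v\<in>S. d u v = sqrt (sqdist e (\<psi> u - \<psi> v))"
        "\<psi> A = (0, 0)" "\<psi> B = (1, 0)" "\<psi> C = (0, 1)" by blast
    obtain a b c :: "real^2" where nc: "\<not> collinear {a, b, c}" and
      abc: "e = (dist a b, dist a c, dist b c)"
      using triangle_with_edges[OF e] .
    have "bij_betw (triangle_point a b c \<circ> \<psi>) S (convex hull {a, b, c})"
      using \<psi>(1) bij_betw_triangle_point[OF nc] by (rule bij_betw_trans)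
    then show ?L
      unfolding isometric_to_triangle_def
      using S nc \<psi>
      by (intro conjI exI[of _ a] exI[of _ b] exI[of _ c] exI[of _ "triangle_point a b c \<circ> \<psi>"])
        (auto simp: abc dist_triangle_point triangle_point_def[of a b c, THEN fun_cong, of "(_, _)"])
  qed
qed

lemma isometric_to_triangle_edges:
  assumes "A \<in> S" "B \<in> S" "C \<in> S"
    and "\<forall>u\<in>S. \<forall>v\<in>S. d u v = sqrt (sqdist e (\<psi> u - \<psi> v))"
    and "\<psi> A = (0, 0)" "\<psi> B = (1, 0)" "\<psi> C = (0, 1)" and "e \<in> topspace triangle_cone"
  shows "(d A B, d A C, d B C) = e"
proof -
  obtain x y z where e: "e = (x, y, z)" by (cases e)
  show ?thesis
    using assms by (simp add: e sqdist_vertices triangle_cone_def)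
qed

lemma isometric_to_triangle_Metric_space:
  assumes "isometric_to_triangle S d A B C"
  shows "Metric_space S (\<lambda>u v. if u \<in> S \<and> v \<in> S then d u v else 0)"
proof -
  obtain \<phi> :: "'a \<Rightarrow> real^2" where inj: "inj_on \<phi> S"
    and d: "\<And>u v. u \<in> S \<Longrightarrow> v \<in> S \<Longrightarrow> d u v = dist (\<phi> u) (\<phi> v)"
    using assms unfolding isometric_to_triangle_def bij_betw_def by metis
  show ?thesis
    by unfold_locales
      (auto simp: d dist_commute inj_on_eq_iff[OF inj] dist_triangle)
qed

section \<open>Trivializing an oriented family\<close>

definition model_family ::
  "'x topology \<Rightarrow> ('x \<Rightarrow> real \<times> real \<times> real) \<Rightarrow> ('x, 'x \<times> real \<times> real) triangle_family" where
  "model_family X e =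
     \<lparr> tot = prod_topology X (top_of_set simplex2),
       proj = fst,
       fdist = (\<lambda>u v. sqrt (sqdist (e (fst u)) (snd u - snd v))),
       ptA = (\<lambda>x. (x, (0, 0))),
       ptB = (\<lambda>x. (x, (1, 0))),
       ptC = (\<lambda>x. (x, (0, 1))) \<rparr>"

text \<open>
  The part of the structure of an oriented family on which inverting an isomorphism and comparing
  edge lengths rest. It is immediate for pullbacks and model families too.
\<close>

definition pointed :: "'x topology \<Rightarrow> ('x, 'e) triangle_family \<Rightarrow> bool" where
  "pointed X F \<longleftrightarrow>
     (\<forall>x \<in> topspace X. ptA F x \<in> fiber F x \<and> ptB F x \<in> fiber F x \<and> ptC F x \<in> fiber F x)"

text \<open>
  Barycentric coordinates with respect to the fibre that contains the point, read off from
  distances alone. This makes them independent of any chosen isometry of the fibre to the plane,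
  and hence continuous on the total space.
\<close>

definition fiber_coords :: "('x, 'e) triangle_family \<Rightarrow> 'e \<Rightarrow> real \<times> real" where
  "fiber_coords F w = (let x = proj F w in
     barycentric (edge_lengths F x)
       ((fdist F w (ptA F x))\<^sup>2) ((fdist F w (ptB F x))\<^sup>2) ((fdist F w (ptC F x))\<^sup>2))"

lemma simplex2_vertices: "(0, 0) \<in> simplex2" "(1, 0) \<in> simplex2" "(0, 1) \<in> simplex2"
  by (simp_all add: simplex2_def)

lemma compact_simplex2: "compact simplex2"
proof -
  have "compact (convex hull {(0, 0), (1, 0), (0, 1) :: real \<times> real})"
    by (rule finite_imp_compact_convex_hull) simp
  moreover have "convex hull {(0, 0), (1, 0), (0, 1) :: real \<times> real} = simplex2"
    by (auto simp: convex_hull_3_alt simplex2_def)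
  ultimately show ?thesis by simp
qed

lemma oriented_family_pointed: "oriented_family X F \<Longrightarrow> pointed X F"
  by (auto simp: oriented_family_def pointed_def isometric_to_triangle_def)

text \<open>
  Any isometry of the fibre to a plane triangle yields some chart to the simplex; recovering its
  coordinates from distances to the vertices shows that the chart is \<open>fiber_coords\<close>.
\<close>

lemma oriented_fiber_chart:
  assumes F: "oriented_family X F" and x: "x \<in> topspace X"
  shows "edge_lengths F x \<in> topspace triangle_cone"
    and "bij_betw (fiber_coords F) (fiber F x) simplex2"
    and "\<And>u v. u \<in> fiber F x \<Longrightarrow> v \<in> fiber F x \<Longrightarrow>
      fdist F u v = sqrt (sqdist (edge_lengths F x) (fiber_coords F u - fiber_coords F v))"
    and "fiber_coords F (ptA F x) = (0, 0)" "fiber_coords F (ptB F x) = (1, 0)"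
      "fiber_coords F (ptC F x) = (0, 1)"
proof -
  let ?S = "fiber F x"
  have "isometric_to_triangle ?S (fdist F) (ptA F x) (ptB F x) (ptC F x)"
    using F x by (auto simp: oriented_family_def)
  then obtain e \<psi> where S: "ptA F x \<in> ?S" "ptB F x \<in> ?S" "ptC F x \<in> ?S"
    and e: "e \<in> topspace triangle_cone"
    and \<psi>: "bij_betw \<psi> ?S simplex2" "\<forall>u\<in>?S. \<forall>v\<in>?S. fdist F u v = sqrt (sqdist e (\<psi> u - \<psi> v))"
      "\<psi> (ptA F x) = (0, 0)" "\<psi> (ptB F x) = (1, 0)" "\<psi> (ptC F x) = (0, 1)"
    unfolding isometric_to_triangle_iff by blast
  have edges: "edge_lengths F x = e"
    unfolding edge_lengths_def using S \<psi>(2-) e by (rule isometric_to_triangle_edges)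
  have coords: "fiber_coords F u = \<psi> u" if u: "u \<in> ?S" for u
  proof -
    have "(fdist F u v)\<^sup>2 = sqdist e (\<psi> u - \<psi> v)" if "v \<in> ?S" for v
      using \<psi>(2) u that sqdist_nonneg[OF e] by simp
    moreover have "proj F u = x" using u by (simp add: fiber_def)
    ultimately show ?thesis
      using barycentric_sqdist[OF e, of "\<psi> u"] S \<psi>(3-)
      by (simp add: fiber_coords_def Let_def edges)
  qed
  show "edge_lengths F x \<in> topspace triangle_cone" using e edges by simp
  show "bij_betw (fiber_coords F) ?S simplex2"
    using \<psi>(1) coords by (simp cong: bij_betw_cong)
  show "fdist F u v = sqrt (sqdist (edge_lengths F x) (fiber_coords F u - fiber_coords F v))"
    if "u \<in> ?S" "v \<in> ?S" for u v
    using that coords \<psi>(2) edges by simp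
  show "fiber_coords F (ptA F x) = (0, 0)" "fiber_coords F (ptB F x) = (1, 0)"
      "fiber_coords F (ptC F x) = (0, 1)"
    using coords S \<psi> by simp_all
qed

lemma continuous_map_pair_iff:
  fixes f :: "'x \<Rightarrow> 'a::topological_space \<times> 'b::topological_space"
  shows "continuous_map X euclidean f \<longleftrightarrow>
    continuous_map X euclidean (\<lambda>x. fst (f x)) \<and> continuous_map X euclidean (\<lambda>x. snd (f x))"
  using continuous_map_pairwise[of X euclidean euclidean f] by (simp add: o_def)

lemma continuous_map_gram:
  assumes "continuous_map X euclidean e"
  shows "continuous_map X euclideanreal (\<lambda>w. gram (e w))"
    and "continuous_map X euclideanreal (\<lambda>w. gram_det (e w))"
  using assms unfolding gram_det_def gram_def case_prod_beta continuous_map_pair_iff[of X]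
  by (auto intro!: continuous_intros)

lemma continuous_map_sqdist:
  assumes "continuous_map X euclidean e" "continuous_map X euclidean p"
  shows "continuous_map X euclideanreal (\<lambda>w. sqdist (e w) (p w))"
  using assms continuous_map_gram[OF assms(1)]
  unfolding sqdist_def case_prod_beta continuous_map_pair_iff[of X]
  by (auto intro!: continuous_intros)

lemma continuous_map_barycentric:
  assumes e: "continuous_map X triangle_cone e"
    and "continuous_map X euclideanreal a" "continuous_map X euclideanreal b" "continuous_map X euclideanreal c"
  shows "continuous_map X euclidean (\<lambda>w. barycentric (e w) (a w) (b w) (c w))"
proof -
  have e': "continuous_map X euclidean e"
    using e by (auto simp: triangle_cone_def continuous_map_in_subtopology)
  have "gram_det (e w) \<noteq> 0" if "w \<in> topspace X" for w
  proof -
    have "e w \<in> topspace triangle_cone" using e that by (auto simp: continuous_map_def)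
    from gram_det_pos[OF this] show ?thesis by simp
  qed
  then show ?thesis
    using e' assms(2-) continuous_map_gram[OF e']
    unfolding barycentric_def Let_def continuous_map_pair_iff[of X]
    by (auto intro!: continuous_intros)
qed

lemma continuous_map_edge_lengths:
  assumes F: "oriented_family X F"
  shows "continuous_map X triangle_cone (edge_lengths F)"
proof -
  have "continuous_map X euclidean (edge_lengths F)"
    using F unfolding oriented_family_def continuous_map_in_subtopology continuous_map_pair_iff[of X] edge_lengths_def
    by simp
  then show ?thesis
    using oriented_fiber_chart(1)[OF F] by (auto simp: triangle_cone_def continuous_map_in_subtopology)
qed

lemma continuous_map_fiber_coords:
  assumes F: "oriented_family X F"
  shows "continuous_map (tot F) euclidean (fiber_coords F)"
proof -
  have p: "continuous_map (tot F) X (proj F)"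
    and d: "continuous_map (fiber_square F) euclideanreal (\<lambda>(u, v). fdist F u v)"
    and sec: "continuous_map X (tot F) (ptA F)" "continuous_map X (tot F) (ptB F)"
      "continuous_map X (tot F) (ptC F)"
    using F by (simp_all add: oriented_family_def continuous_map_in_subtopology)
  have dist: "continuous_map (tot F) euclideanreal (\<lambda>w. fdist F w (s (proj F w)))"
    if s: "continuous_map X (tot F) s" and fib: "\<forall>x\<in>topspace X. s x \<in> fiber F x" for s
  proof -
    have "continuous_map (tot F) (tot F) (\<lambda>w. s (proj F w))"
      using continuous_map_compose[OF p s] by (simp add: o_def)
    moreover have "proj F (s (proj F w)) = proj F w" if "w \<in> topspace (tot F)" for w
      using fib p that by (auto simp: continuous_map_def fiber_def)
    ultimately have "continuous_map (tot F) (fiber_square F) (\<lambda>w. (w, s (proj F w)))"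
      by (auto simp: fiber_square_def continuous_map_in_subtopology continuous_map_paired)
    from continuous_map_compose[OF this d] show ?thesis by (simp add: o_def)
  qed
  have "continuous_map (tot F) triangle_cone (\<lambda>w. edge_lengths F (proj F w))"
    using continuous_map_compose[OF p continuous_map_edge_lengths[OF F]] by (simp add: o_def)
  then show ?thesis
    using oriented_family_pointed[OF F] sec
    unfolding fiber_coords_def[abs_def] Let_def pointed_def
    by (intro continuous_map_barycentric continuous_map_real_pow dist) auto
qed

text \<open>
  The chart is a continuous bijection onto \<open>X \<times> \<Delta>\<close>. What makes its inverse continuous is properness
  of the projection, which the chart inherits because its second component takes values in a
  Hausdorff space.
\<close>

proposition family_iso_model_family:
  assumes F: "oriented_family X F"
  shows "family_iso X F (model_family X (edge_lengths F))"
proof -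
  let ?\<phi> = "\<lambda>w. (proj F w, fiber_coords F w)"
  have fib: "w \<in> fiber F (proj F w)" "proj F w \<in> topspace X" if "w \<in> topspace (tot F)" for w
    using F that by (auto simp: oriented_family_def continuous_map_def fiber_def)
  have "proper_map (tot F) (prod_topology X euclidean) ?\<phi>"
    using F continuous_map_fiber_coords[OF F]
    by (intro proper_map_paired) (simp_all add: oriented_family_def)
  moreover have "continuous_map (tot F) (prod_topology X euclidean) ?\<phi>"
    using F continuous_map_fiber_coords[OF F]
    by (intro continuous_map_pairedI) (simp_all add: oriented_family_def)
  moreover have into: "fiber_coords F w \<in> simplex2" if "w \<in> topspace (tot F)" for w
    using oriented_fiber_chart(2)[OF F fib(2)[OF that]] fib(1)[OF that] by (auto simp: bij_betw_def)
  ultimately have "closed_map (tot F) (prod_topology X (top_of_set simplex2)) ?\<phi>"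
    "continuous_map (tot F) (prod_topology X (top_of_set simplex2)) ?\<phi>"
    using fib(2) unfolding prod_topology_subtopology
    by (auto intro!: proper_imp_closed_map proper_map_into_subtopology continuous_map_into_subtopology)
  moreover have "?\<phi> ` topspace (tot F) = topspace (prod_topology X (top_of_set simplex2))"
  proof
    show "?\<phi> ` topspace (tot F) \<subseteq> topspace (prod_topology X (top_of_set simplex2))"
      using fib(2) into by auto
    show "topspace (prod_topology X (top_of_set simplex2)) \<subseteq> ?\<phi> ` topspace (tot F)"
    proof clarsimp
      fix x s t assume x: "x \<in> topspace X" and "(s, t) \<in> simplex2"
      then obtain w where "w \<in> fiber F x" "fiber_coords F w = (s, t)"
        using oriented_fiber_chart(2)[OF F x] by (metis bij_betw_imp_surj_on imageE)
      then show "(x, s, t) \<in> ?\<phi> ` topspace (tot F)"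
        by (force simp: fiber_def)
    qed
  qed
  moreover have "inj_on ?\<phi> (topspace (tot F))"
  proof (rule inj_onI)
    fix u v assume "u \<in> topspace (tot F)" "v \<in> topspace (tot F)" and eq: "?\<phi> u = ?\<phi> v"
    then have "u \<in> fiber F (proj F u)" "v \<in> fiber F (proj F u)" "proj F u \<in> topspace X"
      using fib by (auto simp: fiber_def)
    then show "u = v"
      using oriented_fiber_chart(2)[OF F, of "proj F u"] eq by (auto simp: bij_betw_def inj_on_def)
  qed
  ultimately have "homeomorphic_map (tot F) (prod_topology X (top_of_set simplex2)) ?\<phi>"
    by (intro bijective_closed_imp_homeomorphic_map)
  moreover have "proj F (ptA F x) = x" "proj F (ptB F x) = x" "proj F (ptC F x) = x"
    if "x \<in> topspace X" for x
    using oriented_family_pointed[OF F] that by (auto simp: pointed_def fiber_def)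
  moreover have "proj F u = x" if "u \<in> fiber F x" for u x using that by (simp add: fiber_def)
  ultimately show ?thesis
    unfolding family_iso_def
    using oriented_fiber_chart(3-)[OF F]
    by (intro exI[of _ ?\<phi>]) (simp add: model_family_def)
qed

section \<open>Isomorphisms of families\<close>

text \<open>
  The inverse map sends the endpoints back only if they lie in the total space, whence the condition
  on \<open>F\<close>.
\<close>

lemma family_iso_sym:
  assumes iso: "family_iso X F G" and F: "pointed X F"
  shows "family_iso X G F"
proof -
  obtain \<phi> where \<phi>: "homeomorphic_map (tot F) (tot G) \<phi>"
    and pr: "\<forall>e \<in> topspace (tot F). proj G (\<phi> e) = proj F e"
    and d: "\<forall>x \<in> topspace X. \<forall>u \<in> fiber F x. \<forall>v \<in> fiber F x. fdist G (\<phi> u) (\<phi> v) = fdist F u v"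
    and pt: "\<forall>x \<in> topspace X. \<phi> (ptA F x) = ptA G x \<and> \<phi> (ptB F x) = ptB G x \<and> \<phi> (ptC F x) = ptC G x"
    using iso unfolding family_iso_def by blast
  obtain \<psi> where \<psi>: "homeomorphic_maps (tot F) (tot G) \<phi> \<psi>"
    using \<phi> homeomorphic_map_maps by blast
  have h: "homeomorphic_map (tot G) (tot F) \<psi>"
    using \<psi> homeomorphic_maps_sym homeomorphic_map_maps by blast
  have left: "\<psi> (\<phi> w) = w" if "w \<in> topspace (tot F)" for w
    using \<psi> that by (simp add: homeomorphic_maps_def)
  have right: "\<phi> (\<psi> w) = w" "\<psi> w \<in> topspace (tot F)" if "w \<in> topspace (tot G)" for w
    using \<psi> that by (auto simp: homeomorphic_maps_def continuous_map_def)
  have fib: "\<psi> w \<in> fiber F x" if "w \<in> fiber G x" for w x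
    using that right pr by (fastforce simp: fiber_def)
  have "proj F (\<psi> w) = proj G w" if "w \<in> topspace (tot G)" for w
    using right[OF that] pr by metis
  moreover have "fdist F (\<psi> u) (\<psi> v) = fdist G u v"
    if "x \<in> topspace X" "u \<in> fiber G x" "v \<in> fiber G x" for x u v
    using d that(1) fib[OF that(2)] fib[OF that(3)] right(1) that(2,3)
    by (metis (no_types, lifting) fiber_def mem_Collect_eq)
  moreover have "\<psi> (ptA G x) = ptA F x \<and> \<psi> (ptB G x) = ptB F x \<and> \<psi> (ptC G x) = ptC F x"
    if "x \<in> topspace X" for x
    using F pt that left by (auto simp: pointed_def fiber_def simp flip: pt)
  ultimately show ?thesis
    using h unfolding family_iso_def by (intro exI[of _ \<psi>]) blast
qed

lemma family_iso_trans:
  assumes "family_iso X F G" "family_iso X G H"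
  shows "family_iso X F H"
proof -
  obtain \<phi> where \<phi>: "homeomorphic_map (tot F) (tot G) \<phi>"
     "\<forall>e \<in> topspace (tot F). proj G (\<phi> e) = proj F e"
     "\<forall>x \<in> topspace X. \<forall>u \<in> fiber F x. \<forall>v \<in> fiber F x. fdist G (\<phi> u) (\<phi> v) = fdist F u v"
     "\<forall>x \<in> topspace X. \<phi> (ptA F x) = ptA G x \<and> \<phi> (ptB F x) = ptB G x \<and> \<phi> (ptC F x) = ptC G x"
    using assms(1) unfolding family_iso_def by blast
  obtain \<psi> where \<psi>: "homeomorphic_map (tot G) (tot H) \<psi>"
     "\<forall>e \<in> topspace (tot G). proj H (\<psi> e) = proj G e"
     "\<forall>x \<in> topspace X. \<forall>u \<in> fiber G x. \<forall>v \<in> fiber G x. fdist H (\<psi> u) (\<psi> v) = fdist G u v"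
     "\<forall>x \<in> topspace X. \<psi> (ptA G x) = ptA H x \<and> \<psi> (ptB G x) = ptB H x \<and> \<psi> (ptC G x) = ptC H x"
    using assms(2) unfolding family_iso_def by blast
  have top: "\<phi> w \<in> topspace (tot G)" if "w \<in> topspace (tot F)" for w
    using \<phi>(1) that homeomorphic_imp_surjective_map by blast
  then have "\<phi> w \<in> fiber G x" if "w \<in> fiber F x" for w x
    using that \<phi>(2) by (auto simp: fiber_def)
  then show ?thesis
    unfolding family_iso_def
    using homeomorphic_map_compose[OF \<phi>(1) \<psi>(1)] \<phi> \<psi> top by (intro exI[of _ "\<psi> \<circ> \<phi>"]) simp
qed

lemma family_iso_edge_lengths:
  assumes "family_iso X F G" "pointed X F" "x \<in> topspace X"
  shows "edge_lengths G x = edge_lengths F x"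
proof -
  obtain \<phi> where
     "\<forall>x \<in> topspace X. \<forall>u \<in> fiber F x. \<forall>v \<in> fiber F x. fdist G (\<phi> u) (\<phi> v) = fdist F u v"
     "\<forall>x \<in> topspace X. \<phi> (ptA F x) = ptA G x \<and> \<phi> (ptB F x) = ptB G x \<and> \<phi> (ptC F x) = ptC G x"
    using assms(1) unfolding family_iso_def by blast
  then show ?thesis
    using assms(2,3) unfolding edge_lengths_def pointed_def by metis
qed

lemma pointed_model_family: "pointed X (model_family X e)"
  by (simp add: pointed_def model_family_def fiber_def simplex2_vertices)

lemma edge_lengths_model_family:
  assumes "e x \<in> topspace triangle_cone"
  shows "edge_lengths (model_family X e) x = e x"
proof -
  obtain a b c where "e x = (a, b, c)" by (cases "e x")
  then show ?thesis
    using assms by (simp add: edge_lengths_def model_family_def sqdist_vertices triangle_cone_def)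
qed

lemma family_iso_model_family_cong:
  assumes "\<And>x. x \<in> topspace X \<Longrightarrow> e x = e' x"
  shows "family_iso X (model_family X e) (model_family X e')"
  unfolding family_iso_def
  using assms by (intro exI[of _ id]) (simp add: model_family_def fiber_def)

lemma proper_map_eq:
  assumes "proper_map X Y f" "\<And>x. x \<in> topspace X \<Longrightarrow> f x = g x"
  shows "proper_map X Y g"
proof -
  have "f ` C = g ` C" if "closedin X C" for C
    using assms(2) closedin_subset[OF that] by (intro image_cong) auto
  moreover have "{x \<in> topspace X. f x = y} = {x \<in> topspace X. g x = y}" for y
    using assms(2) by auto
  ultimately show ?thesis using assms(1) by (simp add: proper_map_def closed_map_def)
qed

text \<open>
  Stated for every family isomorphic to a model family, because the families that realize maps to
  the cone are copies of models on another type. All conditions are read off from \<open>X \<times> \<Delta>\<close> through the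
  isomorphism \<open>\<theta>\<close>; properness of the projection is compactness of the simplex.
\<close>

lemma oriented_family_if_iso_model_family:
  assumes e: "continuous_map X triangle_cone e"
    and iso: "family_iso X G (model_family X e)" and G: "pointed X G"
  shows "oriented_family X G"
proof -
  let ?E = "prod_topology X (top_of_set simplex2)"
  obtain \<theta> where \<theta>: "homeomorphic_map (tot G) ?E \<theta>"
    and pr: "\<And>w. w \<in> topspace (tot G) \<Longrightarrow> fst (\<theta> w) = proj G w"
    and d: "\<And>x u v. x \<in> topspace X \<Longrightarrow> u \<in> fiber G x \<Longrightarrow> v \<in> fiber G x \<Longrightarrow>
      fdist G u v = sqrt (sqdist (e (fst (\<theta> u))) (snd (\<theta> u) - snd (\<theta> v)))"
    and pt: "\<And>x. x \<in> topspace X \<Longrightarrow> \<theta> (ptA G x) = (x, 0, 0)"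
      "\<And>x. x \<in> topspace X \<Longrightarrow> \<theta> (ptB G x) = (x, 1, 0)" "\<And>x. x \<in> topspace X \<Longrightarrow> \<theta> (ptC G x) = (x, 0, 1)"
    using iso unfolding family_iso_def model_family_def by fastforce
  obtain \<tau> where \<tau>: "homeomorphic_maps (tot G) ?E \<theta> \<tau>"
    using \<theta> homeomorphic_map_maps by blast
  have c\<theta>: "continuous_map (tot G) ?E \<theta>" and c\<tau>: "continuous_map ?E (tot G) \<tau>"
    using \<tau> by (simp_all add: homeomorphic_maps_def)
  have \<tau>\<theta>: "\<tau> (\<theta> w) = w" if "w \<in> topspace (tot G)" for w
    using \<tau> that by (simp add: homeomorphic_maps_def)
  have \<theta>\<tau>: "\<theta> (\<tau> q) = q" "\<tau> q \<in> topspace (tot G)" if "q \<in> topspace ?E" for q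
    using \<tau> that by (auto simp: homeomorphic_maps_def continuous_map_def)
  define \<kappa> where "\<kappa> w = snd (\<theta> w)" for w
  have \<theta>_eq: "\<theta> w = (proj G w, \<kappa> w)" if "w \<in> topspace (tot G)" for w
    using pr[OF that] by (simp add: \<kappa>_def prod_eq_iff)
  have top: "proj G w \<in> topspace X" "\<kappa> w \<in> simplex2" if "w \<in> topspace (tot G)" for w
  proof -
    have "\<theta> w \<in> topspace ?E" using c\<theta> that by (auto simp: continuous_map_def)
    then show "proj G w \<in> topspace X" "\<kappa> w \<in> simplex2" by (auto simp: \<theta>_eq[OF that])
  qed
  have cproj: "continuous_map (tot G) X (proj G)"
    using continuous_map_fst_of[OF c\<theta>] by (rule continuous_map_eq) (simp add: pr)
  have c\<kappa>: "continuous_map (tot G) (top_of_set simplex2) \<kappa>"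
    using continuous_map_snd_of[OF c\<theta>] by (rule continuous_map_eq) (simp add: \<kappa>_def)
  then have c\<kappa>': "continuous_map (tot G) euclidean \<kappa>" by (simp add: continuous_map_in_subtopology)
  have e_in: "e x \<in> topspace triangle_cone" if "x \<in> topspace X" for x
    using e that by (auto simp: continuous_map_def)
  have e': "continuous_map X euclidean e"
    using e by (simp add: triangle_cone_def continuous_map_in_subtopology)
  have proper: "proper_map (tot G) X (proj G)"
  proof -
    have "proper_map ?E X fst"
    proof -
      have "compactin ?E {p \<in> topspace ?E. fst p = x}" if "x \<in> topspace X" for x
      proof -
        have "{p \<in> topspace ?E. fst p = x} = {x} \<times> simplex2" using that by auto
        moreover have "compactin ?E ({x} \<times> simplex2)"
          using that compact_simplex2 by (simp add: compactin_Times compactin_subtopology)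
        ultimately show ?thesis by simp
      qed
      moreover have "compact_space (top_of_set simplex2)"
        using compact_simplex2 by (simp add: compact_space_subtopology)
      ultimately show ?thesis
        by (simp add: proper_map_def closed_map_fst)
    qed
    then have p: "proper_map (tot G) X (fst \<circ> \<theta>)"
      using \<theta> homeomorphic_imp_proper_map proper_map_compose by blast
    then show ?thesis by (rule proper_map_eq) (simp add: pr)
  qed
  have trivial: "fiber_bundle (tot G) X (proj G)"
  proof (cases "topspace X = {}")
    case True
    then show ?thesis using cproj by (simp add: fiber_bundle_def)
  next
    case False
    then obtain x0 where x0: "x0 \<in> topspace X" by blast
    \<comment> \<open>The definition of a bundle asks for a typical fibre on the type of the total space, so the
      simplex is represented by the fibre over \<open>x0\<close>. The trivialization is global.\<close>
    let ?T = "subtopology (tot G) (fiber G x0)"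
    let ?\<Phi> = "\<lambda>w. (proj G w, \<tau> (x0, \<kappa> w))"
    have "homeomorphic_maps (tot G) (prod_topology X ?T) ?\<Phi> (\<lambda>(x, v). \<tau> (x, \<kappa> v))"
      unfolding homeomorphic_maps_def
    proof (intro conjI ballI)
      have "continuous_map (tot G) ?E (\<lambda>w. (x0, \<kappa> w))"
        using x0 c\<kappa> by (intro continuous_map_pairedI) simp_all
      from continuous_map_compose[OF this c\<tau>]
      have "continuous_map (tot G) (tot G) (\<lambda>w. \<tau> (x0, \<kappa> w))" by (simp add: o_def)
      moreover have "\<tau> (x0, \<kappa> w) \<in> fiber G x0" if "w \<in> topspace (tot G)" for w
        using \<theta>\<tau>[of "(x0, \<kappa> w)"] pr[of "\<tau> (x0, \<kappa> w)"] x0 top[OF that] by (simp add: fiber_def)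
      ultimately show "continuous_map (tot G) (prod_topology X ?T) ?\<Phi>"
        using cproj by (intro continuous_map_pairedI continuous_map_into_subtopology) auto
      have "continuous_map (prod_topology X ?T) (top_of_set simplex2) (\<kappa> \<circ> snd)"
        using continuous_map_from_subtopology[OF c\<kappa>] continuous_map_snd continuous_map_compose by blast
      then have "continuous_map (prod_topology X ?T) ?E (\<lambda>p. (fst p, \<kappa> (snd p)))"
        by (intro continuous_map_pairedI) (auto simp: continuous_map_fst o_def)
      from continuous_map_compose[OF this c\<tau>]
      show "continuous_map (prod_topology X ?T) (tot G) (\<lambda>(x, v). \<tau> (x, \<kappa> v))"
        by (simp add: o_def case_prod_beta')
    next
      fix w assume w: "w \<in> topspace (tot G)"
      have "\<kappa> (\<tau> (x0, \<kappa> w)) = \<kappa> w"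
        using \<theta>\<tau>[of "(x0, \<kappa> w)"] x0 top[OF w] by (simp add: \<kappa>_def)
      then show "(case ?\<Phi> w of (x, v) \<Rightarrow> \<tau> (x, \<kappa> v)) = w"
        using \<tau>\<theta>[OF w] \<theta>_eq[OF w] by simp
    next
      fix q assume "q \<in> topspace (prod_topology X ?T)"
      then obtain x v where q: "q = (x, v)" "x \<in> topspace X" and v: "v \<in> topspace (tot G)" "proj G v = x0"
        by (auto simp: fiber_def)
      have "\<theta> (\<tau> (x, \<kappa> v)) = (x, \<kappa> v)" "\<tau> (x, \<kappa> v) \<in> topspace (tot G)"
        using \<theta>\<tau>[of "(x, \<kappa> v)"] q top[OF v(1)] by simp_all
      then have "proj G (\<tau> (x, \<kappa> v)) = x" "\<kappa> (\<tau> (x, \<kappa> v)) = \<kappa> v"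
        using \<theta>_eq by simp_all
      moreover have "\<tau> (x0, \<kappa> v) = v"
        using \<tau>\<theta>[OF v(1)] \<theta>_eq[OF v(1)] v(2) by simp
      ultimately show "?\<Phi> (case q of (x, v) \<Rightarrow> \<tau> (x, \<kappa> v)) = q" by (simp add: q)
    qed
    then have "homeomorphic_map (tot G) (prod_topology X ?T) ?\<Phi>"
      using homeomorphic_map_maps by blast
    moreover have "{w \<in> topspace (tot G). proj G w \<in> topspace X} = topspace (tot G)"
      using top by auto
    ultimately show ?thesis
      unfolding fiber_bundle_def using cproj
      by (intro conjI exI[of _ ?T] ballI exI[of _ "topspace X"] exI[of _ ?\<Phi>]) auto
  qed
  have dist: "continuous_map (fiber_square G) (top_of_set {0..}) (\<lambda>(u, v). fdist G u v)"
  proof (rule continuous_map_eq)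
    let ?Q = "fiber_square G"
    have f: "continuous_map ?Q (tot G) fst" "continuous_map ?Q (tot G) snd"
      unfolding fiber_square_def by (rule continuous_intros)+
    have "continuous_map ?Q euclidean (\<lambda>q. e (proj G (fst q)))"
      using continuous_map_compose[OF continuous_map_compose[OF f(1) cproj] e'] by (simp add: o_def)
    moreover have "continuous_map ?Q euclidean (\<lambda>q. \<kappa> (fst q) - \<kappa> (snd q))"
      using continuous_map_compose[OF f(1) c\<kappa>'] continuous_map_compose[OF f(2) c\<kappa>']
      unfolding continuous_map_pair_iff[of ?Q] o_def by (simp add: continuous_map_diff)
    ultimately have "continuous_map ?Q euclideanreal
        (\<lambda>q. sqrt (sqdist (e (proj G (fst q))) (\<kappa> (fst q) - \<kappa> (snd q))))"
      by (intro continuous_map_sqrt continuous_map_sqdist)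
    moreover have "proj G (fst q) \<in> topspace X" if "q \<in> topspace ?Q" for q
      using that top by (auto simp: fiber_square_def)
    ultimately show "continuous_map ?Q (top_of_set {0..})
        (\<lambda>q. sqrt (sqdist (e (proj G (fst q))) (\<kappa> (fst q) - \<kappa> (snd q))))"
      using sqdist_nonneg[OF e_in] by (intro continuous_map_into_subtopology) auto
    show "sqrt (sqdist (e (proj G (fst q))) (\<kappa> (fst q) - \<kappa> (snd q))) = (case q of (u, v) \<Rightarrow> fdist G u v)"
      if q: "q \<in> topspace ?Q" for q
    proof -
      obtain u v where "q = (u, v)" "u \<in> fiber G (proj G u)" "v \<in> fiber G (proj G u)" "proj G u \<in> topspace X"
        using q top by (auto simp: fiber_square_def fiber_def)
      then show ?thesis using d pr by (simp add: \<kappa>_def fiber_def)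
    qed
  qed
  have tri: "isometric_to_triangle (fiber G x) (fdist G) (ptA G x) (ptB G x) (ptC G x)"
    if x: "x \<in> topspace X" for x
  proof -
    have "inj_on \<kappa> (fiber G x)"
    proof (rule inj_onI)
      fix u v assume "u \<in> fiber G x" "v \<in> fiber G x" "\<kappa> u = \<kappa> v"
      then have "\<theta> u = \<theta> v" "u \<in> topspace (tot G)" "v \<in> topspace (tot G)"
        by (simp_all add: fiber_def \<theta>_eq)
      then show "u = v" using \<tau>\<theta> by metis
    qed
    moreover have "\<kappa> ` fiber G x = simplex2"
    proof
      show "\<kappa> ` fiber G x \<subseteq> simplex2" using top by (auto simp: fiber_def)
      show "simplex2 \<subseteq> \<kappa> ` fiber G x"
      proof
        fix p assume "p \<in> simplex2"
        then have "\<theta> (\<tau> (x, p)) = (x, p)" "\<tau> (x, p) \<in> topspace (tot G)"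
          using \<theta>\<tau>[of "(x, p)"] x by simp_all
        then show "p \<in> \<kappa> ` fiber G x" using \<theta>_eq
          by (intro image_eqI[of _ _ "\<tau> (x, p)"]) (simp_all add: fiber_def)
      qed
    qed
    moreover have "fdist G u v = sqrt (sqdist (e x) (\<kappa> u - \<kappa> v))"
      if "u \<in> fiber G x" "v \<in> fiber G x" for u v
      using d[OF x that] pr that by (simp add: fiber_def \<kappa>_def)
    moreover have "\<kappa> (ptA G x) = (0, 0)" "\<kappa> (ptB G x) = (1, 0)" "\<kappa> (ptC G x) = (0, 1)"
      using pt x by (simp_all add: \<kappa>_def)
    ultimately show ?thesis
      unfolding isometric_to_triangle_iff
      using G x e_in[OF x] by (auto simp: pointed_def bij_betw_def)
  qed
  have sec: "continuous_map X (tot G) s"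
    if s: "\<And>x. x \<in> topspace X \<Longrightarrow> \<theta> (s x) = (x, p)" and p: "p \<in> simplex2"
      and sG: "\<And>x. x \<in> topspace X \<Longrightarrow> s x \<in> fiber G x" for s p
  proof (rule continuous_map_eq)
    have "continuous_map X ?E (\<lambda>x. (x, p))"
      using p by (intro continuous_map_pairedI) simp_all
    from continuous_map_compose[OF this c\<tau>] show "continuous_map X (tot G) (\<lambda>x. \<tau> (x, p))"
      by (simp add: o_def)
    show "\<tau> (x, p) = s x" if "x \<in> topspace X" for x
      using \<tau>\<theta>[of "s x"] s[OF that] sG[OF that] by (simp add: fiber_def)
  qed
  have edges: "edge_lengths G x = e x" if x: "x \<in> topspace X" for x
    using family_iso_edge_lengths[OF iso G x] edge_lengths_model_family[of e x, OF e_in[OF x]] by simp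
  have nonneg: "0 \<le> fst (e x)" "0 \<le> fst (snd (e x))" "0 \<le> snd (snd (e x))" if "x \<in> topspace X" for x
    using e_in[OF that] by (auto simp: triangle_cone_def case_prod_beta)
  have "continuous_map X (top_of_set {0..}) (\<lambda>x. fst (e x))"
    "continuous_map X (top_of_set {0..}) (\<lambda>x. fst (snd (e x)))"
    "continuous_map X (top_of_set {0..}) (\<lambda>x. snd (snd (e x)))"
    using e' nonneg unfolding continuous_map_pair_iff[of X]
    by (auto intro!: continuous_map_into_subtopology)
  then have "continuous_map X (top_of_set {0..}) (\<lambda>x. fdist G (ptA G x) (ptB G x)) \<and>
     continuous_map X (top_of_set {0..}) (\<lambda>x. fdist G (ptA G x) (ptC G x)) \<and>
     continuous_map X (top_of_set {0..}) (\<lambda>x. fdist G (ptB G x) (ptC G x))"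
    using edges by (intro conjI) (erule continuous_map_eq; simp add: edge_lengths_def flip: edges; fail)+
  then show ?thesis
    unfolding oriented_family_def
    using cproj proper trivial dist tri isometric_to_triangle_Metric_space[OF tri]
      sec[OF pt(1) simplex2_vertices(1)] sec[OF pt(2) simplex2_vertices(2)]
      sec[OF pt(3) simplex2_vertices(3)] G
    by (simp add: pointed_def)
qed

section \<open>Transporting a family to another type\<close>

text \<open>
  Transport of structure: the image of \<open>h\<close> carries the topology that makes \<open>h\<close> a homeomorphism
  onto it.
\<close>

lemma pushforward_family:
  fixes F :: "('x, 'e) triangle_family" and h :: "'e \<Rightarrow> 'g"
  assumes h: "inj h" and F: "pointed X F"
  obtains G :: "('x, 'g) triangle_family" where "family_iso X F G" "pointed X G"
proof -
  let ?k = "inv h"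
  define G :: "('x, 'g) triangle_family" where
    "G = \<lparr> tot = pullback_topology (range h) ?k (tot F), proj = proj F \<circ> ?k,
       fdist = (\<lambda>u v. fdist F (?k u) (?k v)),
       ptA = h \<circ> ptA F, ptB = h \<circ> ptB F, ptC = h \<circ> ptC F \<rparr>"
  have k: "?k (h w) = w" for w using h by simp
  have "continuous_map (tot F) (tot G) h"
    unfolding G_def triangle_family.simps
    by (rule continuous_map_pullback') (auto simp: o_def k)
  moreover have "continuous_map (tot G) (tot F) ?k"
    unfolding G_def triangle_family.simps
    using continuous_map_pullback[OF continuous_map_id] by (simp add: o_def)
  moreover have "h (?k w) = w" if "w \<in> topspace (tot G)" for w
    using that by (auto simp: G_def topspace_pullback_topology f_inv_into_f)
  ultimately have "homeomorphic_maps (tot F) (tot G) h ?k"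
    by (simp add: homeomorphic_maps_def k)
  then have hom: "homeomorphic_map (tot F) (tot G) h"
    using homeomorphic_map_maps by blast
  have "h w \<in> fiber G x" if "w \<in> fiber F x" for w x
    using that by (simp add: fiber_def G_def topspace_pullback_topology k)
  then have "pointed X G" using F by (simp add: pointed_def G_def)
  moreover have "family_iso X F G"
    unfolding family_iso_def by (intro exI[of _ h]) (use hom in \<open>simp add: G_def k\<close>)
  ultimately show ?thesis using that by blast
qed

text \<open>
  An infinite set is equipollent to its square, and \<open>'u\<close> contains a copy of the reals.
\<close>

lemma exists_inj_times_plane:
  assumes "(UNIV :: real set) \<lesssim> (UNIV :: 'u set)"
  shows "\<exists>h :: 'u \<times> real \<times> real \<Rightarrow> 'u. inj h"
proof -
  obtain r :: "real \<Rightarrow> 'u" where r: "inj r" using assms by (auto simp: lepoll_def)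
  then have "infinite (UNIV :: 'u set)"
    by (metis finite_imageD finite_subset infinite_UNIV_char_0 subset_UNIV)
  from card_of_Times_same_infinite[OF this]
  obtain s :: "'u \<times> 'u \<Rightarrow> 'u" where "bij_betw s (UNIV \<times> UNIV) UNIV"
    unfolding card_of_ordIso[symmetric] by blast
  then have s: "inj s" by (simp add: bij_betw_def)
  have "inj (\<lambda>(u, a, b). s (u, s (r a, r b)))"
    by (rule injI) (auto dest!: injD[OF r] injD[OF s])
  then show ?thesis by blast
qed

section \<open>The classifying map of a family\<close>

definition classifying_map :: "'x topology \<Rightarrow> ('x, 'e) triangle_family \<Rightarrow> 'x \<Rightarrow> real \<times> real \<times> real" where
  "classifying_map X F = restrict (edge_lengths F) (topspace X)"

lemma classifying_map_in_Hom:
  assumes "oriented_family X F"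
  shows "classifying_map X F \<in> Hom_Top X triangle_cone"
  unfolding Hom_Top_def classifying_map_def
  using continuous_map_eq[OF continuous_map_edge_lengths[OF assms]] by simp

text \<open>
  The family is a copy on \<open>'u\<close> of the model family of \<open>e\<close>.
\<close>

lemma classifying_map_surj:
  fixes X :: "'u topology"
  assumes "(UNIV :: real set) \<lesssim> (UNIV :: 'u set)" and e: "e \<in> Hom_Top X triangle_cone"
  shows "\<exists>F \<in> families X. classifying_map X F = e"
proof -
  obtain h :: "'u \<times> real \<times> real \<Rightarrow> 'u" where "inj h"
    using exists_inj_times_plane[OF assms(1)] by blast
  then obtain G :: "('u, 'u) triangle_family" where iso: "family_iso X (model_family X e) G" and G: "pointed X G"
    using pushforward_family[OF _ pointed_model_family] by blast
  have e': "continuous_map X triangle_cone e" "e \<in> extensional (topspace X)"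
    using e by (auto simp: Hom_Top_def)
  have "oriented_family X G"
    using e'(1) family_iso_sym[OF iso pointed_model_family] G
    by (rule oriented_family_if_iso_model_family)
  moreover have "edge_lengths G x = e x" if "x \<in> topspace X" for x
  proof -
    have "e x \<in> topspace triangle_cone" using e'(1) that by (auto simp: continuous_map_def)
    then show ?thesis
      using family_iso_edge_lengths[OF iso pointed_model_family that] edge_lengths_model_family by simp
  qed
  then have "classifying_map X G = e"
    using e'(2) by (auto simp: classifying_map_def extensional_def)
  ultimately show ?thesis by (auto simp: families_def)
qed

lemma family_iso_if_iso_model_families:
  assumes "family_iso X F (model_family X e)" "family_iso X G (model_family X e')" "pointed X G"
    and "\<And>x. x \<in> topspace X \<Longrightarrow> e x = e' x"
  shows "family_iso X F G"
  using family_iso_trans[OF family_iso_trans[OF assms(1) family_iso_model_family_cong[OF assms(4)]]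
      family_iso_sym[OF assms(2,3)]] .

lemma classifying_map_eq_iff:
  "classifying_map X F = classifying_map X G \<longleftrightarrow> (\<forall>x \<in> topspace X. edge_lengths F x = edge_lengths G x)"
  by (auto simp: classifying_map_def fun_eq_iff restrict_def)

text \<open>
  Each family is isomorphic to the model family of its own edge lengths, and isomorphisms preserve
  edge lengths.
\<close>

theorem family_iso_iff_classifying_map_eq:
  assumes F: "oriented_family X F" and G: "oriented_family X G"
  shows "family_iso X F G \<longleftrightarrow> classifying_map X F = classifying_map X G"
proof
  assume "family_iso X F G"
  then show "classifying_map X F = classifying_map X G"
    using family_iso_edge_lengths oriented_family_pointed[OF F] by (fastforce simp: classifying_map_eq_iff)
next
  assume "classifying_map X F = classifying_map X G"
  then show "family_iso X F G"
    using family_iso_if_iso_model_families[OF family_iso_model_family[OF F] family_iso_model_family[OF G]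
        oriented_family_pointed[OF G]] by (auto simp: classifying_map_eq_iff)
qed

lemma pointed_pullback_family:
  assumes "continuous_map Y X f" "pointed X F"
  shows "pointed Y (pullback_family Y f F)"
  using assms by (auto simp: pointed_def pullback_family_def fiber_def continuous_map_def Pi_iff)

lemma edge_lengths_pullback_family: "edge_lengths (pullback_family Y f F) y = edge_lengths F (f y)"
  by (simp add: edge_lengths_def pullback_family_def)

text \<open>
  Pulling back \<open>X \<times> \<Delta>\<close> along \<open>f\<close> gives \<open>Y \<times> \<Delta>\<close>: the coordinate in the simplex is kept and the base
  point is replaced. In this way the fibre product is handled through a model family as well.
\<close>

lemma pullback_family_iso_model_family:
  assumes f: "continuous_map Y X f" and iso: "family_iso X F (model_family X e)"
  shows "family_iso Y (pullback_family Y f F) (model_family Y (e \<circ> f))"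
proof -
  let ?D = "top_of_set simplex2" and ?P = "pullback_family Y f F"
  obtain \<theta> where \<theta>: "homeomorphic_map (tot F) (prod_topology X ?D) \<theta>"
    and pr: "\<And>w. w \<in> topspace (tot F) \<Longrightarrow> fst (\<theta> w) = proj F w"
    and d: "\<And>x u v. x \<in> topspace X \<Longrightarrow> u \<in> fiber F x \<Longrightarrow> v \<in> fiber F x \<Longrightarrow>
      fdist F u v = sqrt (sqdist (e (fst (\<theta> u))) (snd (\<theta> u) - snd (\<theta> v)))"
    and pt: "\<And>x. x \<in> topspace X \<Longrightarrow> \<theta> (ptA F x) = (x, 0, 0)"
      "\<And>x. x \<in> topspace X \<Longrightarrow> \<theta> (ptB F x) = (x, 1, 0)" "\<And>x. x \<in> topspace X \<Longrightarrow> \<theta> (ptC F x) = (x, 0, 1)"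
    using iso unfolding family_iso_def model_family_def by fastforce
  obtain \<tau> where \<tau>: "homeomorphic_maps (tot F) (prod_topology X ?D) \<theta> \<tau>"
    using \<theta> homeomorphic_map_maps by blast
  have c\<theta>: "continuous_map (tot F) (prod_topology X ?D) \<theta>" and c\<tau>: "continuous_map (prod_topology X ?D) (tot F) \<tau>"
    using \<tau> by (simp_all add: homeomorphic_maps_def)
  have \<tau>\<theta>: "\<tau> (\<theta> w) = w" if "w \<in> topspace (tot F)" for w
    using \<tau> that by (simp add: homeomorphic_maps_def)
  have \<theta>\<tau>: "\<theta> (\<tau> q) = q" "\<tau> q \<in> topspace (tot F)" if "q \<in> topspace (prod_topology X ?D)" for q
    using \<tau> that by (auto simp: homeomorphic_maps_def continuous_map_def)
  have fY: "f y \<in> topspace X" if "y \<in> topspace Y" for y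
    using f that by (auto simp: continuous_map_def)
  have P: "tot ?P = subtopology (prod_topology Y (tot F)) {(y, w). f y = proj F w}"
    by (simp add: pullback_family_def)
  let ?\<phi> = "\<lambda>(y, w). (y, snd (\<theta> w))" and ?\<psi> = "\<lambda>(y, t). (y, \<tau> (f y, t))"
  have "homeomorphic_maps (tot ?P) (prod_topology Y ?D) ?\<phi> ?\<psi>"
    unfolding homeomorphic_maps_def
  proof (intro conjI ballI)
    have "continuous_map (tot ?P) (tot F) snd" "continuous_map (tot ?P) Y fst"
      unfolding P by (rule continuous_intros)+
    from continuous_map_compose[OF this(1) continuous_map_snd_of[OF c\<theta>]] this(2)
    show "continuous_map (tot ?P) (prod_topology Y ?D) ?\<phi>"
      by (simp add: case_prod_beta' continuous_map_paired o_def)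
  next
    have "continuous_map (prod_topology Y ?D) (prod_topology X ?D) (\<lambda>q. (f (fst q), snd q))"
      using continuous_map_compose[OF continuous_map_fst f]
      by (intro continuous_map_pairedI) (auto simp: o_def continuous_map_snd)
    from continuous_map_compose[OF this c\<tau>]
    have "continuous_map (prod_topology Y ?D) (prod_topology Y (tot F)) ?\<psi>"
      by (simp add: case_prod_beta' continuous_map_paired o_def continuous_map_fst)
    moreover have "f y = proj F (\<tau> (f y, t))" if "y \<in> topspace Y" "t \<in> simplex2" for y t
      using \<theta>\<tau>[of "(f y, t)"] pr[of "\<tau> (f y, t)"] fY that by simp
    ultimately show "continuous_map (prod_topology Y ?D) (tot ?P) ?\<psi>"
      unfolding P by (intro continuous_map_into_subtopology) auto
  next
    fix q assume "q \<in> topspace (tot ?P)"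
    then obtain y w where q: "q = (y, w)" "y \<in> topspace Y" "w \<in> topspace (tot F)" "f y = proj F w"
      by (auto simp: P)
    then have "(f y, snd (\<theta> w)) = \<theta> w" using pr by (simp add: prod_eq_iff)
    then show "?\<psi> (?\<phi> q) = q" using \<tau>\<theta> q by simp
  next
    fix q assume "q \<in> topspace (prod_topology Y ?D)"
    then show "?\<phi> (?\<psi> q) = q" using \<theta>\<tau> fY by auto
  qed
  then have "homeomorphic_map (tot ?P) (prod_topology Y ?D) ?\<phi>"
    using homeomorphic_map_maps by blast
  moreover have "fdist F (snd u) (snd v) = sqrt (sqdist (e (f y)) (snd (\<theta> (snd u)) - snd (\<theta> (snd v))))"
    if "y \<in> topspace Y" "u \<in> fiber ?P y" "v \<in> fiber ?P y" for y u v
  proof -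
    have "snd u \<in> fiber F (f y)" "snd v \<in> fiber F (f y)"
      using that by (auto simp: fiber_def pullback_family_def)
    then show ?thesis using d[OF fY[OF that(1)]] pr by (simp add: fiber_def)
  qed
  moreover have "fst u = y" if "u \<in> fiber ?P y" for u y
    using that by (simp add: fiber_def pullback_family_def)
  ultimately show ?thesis
    unfolding family_iso_def
    by (intro exI[of _ ?\<phi>]) (simp add: model_family_def case_prod_beta, simp add: pullback_family_def pt fY)
qed

text \<open>
  Naturality of the classifying map, with an arbitrary family \<open>G\<close> representing the class of the pullback
  because the fibre product itself has its total space on a different type.
\<close>

theorem pullback_family_iso_iff:
  assumes F: "oriented_family X F" and G: "oriented_family Y G" and f: "continuous_map Y X f"
  shows "family_iso Y (pullback_family Y f F) G \<longleftrightarrow>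
    classifying_map Y G = compose (topspace Y) (classifying_map X F) f" (is "?L \<longleftrightarrow> ?R")
proof -
  have fY: "f y \<in> topspace X" if "y \<in> topspace Y" for y
    using f that by (auto simp: continuous_map_def)
  then have R: "?R \<longleftrightarrow> (\<forall>y \<in> topspace Y. edge_lengths G y = edge_lengths F (f y))"
    by (auto simp: classifying_map_def compose_def fun_eq_iff restrict_def)
  show ?thesis unfolding R
  proof
    assume ?L
    from family_iso_edge_lengths[OF this pointed_pullback_family[OF f oriented_family_pointed[OF F]]]
    show "\<forall>y \<in> topspace Y. edge_lengths G y = edge_lengths F (f y)"
      by (simp add: edge_lengths_pullback_family)
  next
    assume "\<forall>y \<in> topspace Y. edge_lengths G y = edge_lengths F (f y)"
    then show ?L
      using family_iso_if_iso_model_families[OF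
          pullback_family_iso_model_family[OF f family_iso_model_family[OF F]]
          family_iso_model_family[OF G] oriented_family_pointed[OF G]] by simp
  qed
qed

section \<open>The fine moduli space\<close>

text \<open>
  Isomorphism classes are the fibres of the classifying map, so the moduli functor is determined by
  classifying maps and composition.
\<close>

lemma iso_class_eq:
  assumes "F \<in> families X"
  shows "iso_class X F = {G \<in> families X. classifying_map X G = classifying_map X F}"
  using assms family_iso_iff_classifying_map_eq
  by (fastforce simp: iso_class_def iso_rel_def families_def)

lemma triangles_ob_eq: "triangles_ob X = iso_class X ` families X"
  by (auto simp: triangles_ob_def quotient_def iso_class_def)

lemma triangles_mor_iso_class:
  assumes F: "F \<in> families X" and f: "f \<in> Hom_Top Y X"
  shows "triangles_mor Y X f (iso_class X F)
    = {G \<in> families Y. classifying_map Y G = compose (topspace Y) (classifying_map X F) f}"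
proof -
  have "family_iso Y (pullback_family Y f F') G \<longleftrightarrow>
      classifying_map Y G = compose (topspace Y) (classifying_map X F) f"
    if "F' \<in> iso_class X F" "G \<in> families Y" for F' G
    using that f iso_class_eq[OF F] pullback_family_iso_iff[of X F' Y G f]
    by (simp add: families_def Hom_Top_def)
  moreover have "F \<in> iso_class X F" using F by (simp add: iso_class_eq)
  ultimately show ?thesis unfolding triangles_mor_def by blast
qed

lemma compose_in_Hom_Top:
  assumes "f \<in> Hom_Top Y X" "g \<in> Hom_Top X Z"
  shows "compose (topspace Y) g f \<in> Hom_Top Y Z"
proof -
  have "continuous_map Y Z (g \<circ> f)"
    using assms continuous_map_compose by (auto simp: Hom_Top_def)
  then have "continuous_map Y Z (compose (topspace Y) g f)"
    by (rule continuous_map_eq) (simp add: compose_def)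
  then show ?thesis by (simp add: Hom_Top_def)
qed

text \<open>
  Such a \<open>G\<close> realizes the composite of the classifying map of \<open>F\<close> with \<open>f\<close>; its class is then the
  class of the pullback, which is in particular not empty.
\<close>

lemma triangles_mor_iso_class_pullback:
  fixes X Y :: "'u topology"
  assumes "(UNIV :: real set) \<lesssim> (UNIV :: 'u set)" and F: "F \<in> families X" and f: "f \<in> Hom_Top Y X"
  obtains G where "G \<in> families Y" "triangles_mor Y X f (iso_class X F) = iso_class Y G"
    "classifying_map Y G = compose (topspace Y) (classifying_map X F) f"
proof -
  have "compose (topspace Y) (classifying_map X F) f \<in> Hom_Top Y triangle_cone"
    using f classifying_map_in_Hom F by (intro compose_in_Hom_Top) (auto simp: families_def)
  then obtain G where G: "G \<in> families Y" "classifying_map Y G = compose (topspace Y) (classifying_map X F) f"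
    using classifying_map_surj[OF assms(1)] by blast
  then have "triangles_mor Y X f (iso_class X F) = iso_class Y G"
    unfolding triangles_mor_iso_class[OF F f] iso_class_eq[OF G(1)] by simp
  with G show ?thesis using that by blast
qed

theorem theorem2p4:
  assumes "(UNIV :: real set) \<lesssim> (UNIV :: 'u set)"
  shows "moduli_problem (triangles_ob :: 'u topology \<Rightarrow> _) triangles_mor \<and>
    (\<exists>\<eta>. fine_moduli_space_via (triangles_ob :: 'u topology \<Rightarrow> _) triangles_mor triangle_cone \<eta> \<and>
      (\<forall>X. \<forall>F \<in> families X. \<forall>x \<in> topspace X. \<eta> X (iso_class X F) x = edge_lengths F x))"
proof -
  \<comment> \<open>The classifying map of a class, computed on an arbitrary representative.\<close>
  define \<eta> :: "'u topology \<Rightarrow> ('u, 'u) triangle_family set \<Rightarrow> 'u \<Rightarrow> real \<times> real \<times> real" where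
    "\<eta> X c = classifying_map X (SOME F. F \<in> c)" for X c
  have \<eta>: "\<eta> X (iso_class X F) = classifying_map X F" if "F \<in> families X" for X and F :: "('u, 'u) triangle_family"
  proof -
    have "classifying_map X G = classifying_map X F" if "G \<in> iso_class X F" for G
      using that iso_class_eq[OF \<open>F \<in> families X\<close>] by blast
    moreover have "F \<in> iso_class X F" using that by (simp add: iso_class_eq)
    ultimately show ?thesis unfolding \<eta>_def by (rule someI2[rotated])
  qed
  have "moduli_problem (triangles_ob :: 'u topology \<Rightarrow> _) triangles_mor"
    unfolding moduli_problem_def
  proof (intro conjI allI ballI)
    fix X Y :: "'u topology" and f c
    assume f: "f \<in> Hom_Top Y X" and c: "c \<in> triangles_ob X"
    from c obtain F where F: "F \<in> families X" "c = iso_class X F" by (auto simp: triangles_ob_eq)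
    then show "triangles_mor Y X f c \<in> triangles_ob Y"
      using triangles_mor_iso_class_pullback[OF assms F(1) f] by (auto simp: triangles_ob_eq)
  next
    fix X :: "'u topology" and c assume "c \<in> triangles_ob X"
    then obtain F where F: "F \<in> families X" "c = iso_class X F" by (auto simp: triangles_ob_eq)
    have id: "restrict id (topspace X) \<in> Hom_Top X X"
      using continuous_map_eq[OF continuous_map_id, of X "restrict id (topspace X)"]
      by (simp add: Hom_Top_def)
    have comp: "compose (topspace X) (classifying_map X F) (restrict id (topspace X)) = classifying_map X F"
      by (auto simp: compose_def classifying_map_def fun_eq_iff)
    show "triangles_mor X X (restrict id (topspace X)) c = c"
      unfolding F(2) triangles_mor_iso_class[OF F(1) id] comp
      unfolding iso_class_eq[OF F(1)] ..
  next
    fix X Y Z :: "'u topology" and f g c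
    assume f: "f \<in> Hom_Top Y X" and g: "g \<in> Hom_Top Z Y" and c: "c \<in> triangles_ob X"
    from c obtain F where F: "F \<in> families X" "c = iso_class X F" by (auto simp: triangles_ob_eq)
    obtain G where G: "G \<in> families Y" "triangles_mor Y X f c = iso_class Y G"
      "classifying_map Y G = compose (topspace Y) (classifying_map X F) f"
      by (rule triangles_mor_iso_class_pullback[OF assms F(1) f, folded F(2)])
    have "g z \<in> topspace Y" if "z \<in> topspace Z" for z
      using g that by (auto simp: Hom_Top_def continuous_map_def)
    then have comp: "compose (topspace Z) (classifying_map X F) (compose (topspace Z) f g)
        = compose (topspace Z) (classifying_map Y G) g"
      by (auto simp: G(3) compose_def)
    show "triangles_mor Z X (compose (topspace Z) f g) c = triangles_mor Z Y g (triangles_mor Y X f c)"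
      unfolding G(2) unfolding F(2) triangles_mor_iso_class[OF F(1) compose_in_Hom_Top[OF g f]]
        triangles_mor_iso_class[OF G(1) g] comp ..
  qed
  moreover have "fine_moduli_space_via (triangles_ob :: 'u topology \<Rightarrow> _) triangles_mor triangle_cone \<eta>"
    unfolding fine_moduli_space_via_def
  proof (intro conjI allI ballI)
    fix X :: "'u topology"
    show "bij_betw (\<eta> X) (triangles_ob X) (Hom_Top X triangle_cone)"
      unfolding bij_betw_def
    proof
      show "inj_on (\<eta> X) (triangles_ob X)"
      proof (rule inj_onI)
        fix c c' assume c: "c \<in> triangles_ob X" "c' \<in> triangles_ob X" and eq: "\<eta> X c = \<eta> X c'"
        obtain F F' where F: "F \<in> families X" "c = iso_class X F" "F' \<in> families X" "c' = iso_class X F'"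
          using c unfolding triangles_ob_eq by blast
        have "classifying_map X F = classifying_map X F'"
          using eq unfolding F(2,4) \<eta>[OF F(1)] \<eta>[OF F(3)] .
        then show "c = c'"
          unfolding F(2,4) iso_class_eq[OF F(1)] iso_class_eq[OF F(3)] by simp
      qed
      have "\<eta> X ` triangles_ob X = classifying_map X ` families X"
        unfolding triangles_ob_eq image_image by (intro image_cong refl \<eta>)
      also have "\<dots> = Hom_Top X triangle_cone"
      proof
        show "classifying_map X ` families X \<subseteq> Hom_Top X triangle_cone"
          using classifying_map_in_Hom by (fastforce simp: families_def)
        show "Hom_Top X triangle_cone \<subseteq> classifying_map X ` families X"
          using classifying_map_surj[OF assms] by blast
      qed
      finally show "\<eta> X ` triangles_ob X = Hom_Top X triangle_cone" .
    qed
  next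
    fix X Y :: "'u topology" and f c
    assume f: "f \<in> Hom_Top Y X" and c: "c \<in> triangles_ob X"
    from c obtain F where F: "F \<in> families X" "c = iso_class X F" by (auto simp: triangles_ob_eq)
    obtain G where "G \<in> families Y" "triangles_mor Y X f c = iso_class Y G"
      "classifying_map Y G = compose (topspace Y) (classifying_map X F) f"
      by (rule triangles_mor_iso_class_pullback[OF assms F(1) f, folded F(2)])
    then show "\<eta> Y (triangles_mor Y X f c) = compose (topspace Y) (\<eta> X c) f"
      using F \<eta> by simp
  qed
  ultimately show ?thesis
    using \<eta> by (intro conjI exI[of _ \<eta>]) (auto simp: classifying_map_def)
qed

end
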